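(* Let $(X,d)$ be a metric space and let $n\ge 0$ be an integer. The macroscopic Nagata-Assouad dimension of $(X,d)$ is at most $n$ if and only if $\mathrm{asdim}(X)\le n$ with the Higson property.
   Context: A family of subsets of a metric space is $r$-disjoint if any two points lying in two different members of the family are at distance at least $r$. A metric space $Y$ satisfies $\dim_{NA}(Y)\le n$ (Nagata-Assouad dimension at most $n$) if there is $C>0$ such that for all $r>0$ there is a cover $\mathcal{U}=\bigcup_{i=1}^{n+1}\mathcal{U}_i$ of $Y$ such that each $\mathcal{U}_i$ is $r$-disjoint and every element of $\mathcal{U}$ has diameter at most $C r$. For $\epsilon>0$, $\max(d,\epsilon)$ denotes the metric on $X$ whose value at $(x,y)$ is $\max(d(x,y),\epsilon)$ if $x\ne y$ and $0$ if $x=y$. The macroscopic Nagata-Assouad dimension of $(X,d)$ is $\dim_{NA}(X,\max(d,1))$. $\mathrm{asdim}(X)\le n$ with the Higson property means: there is $C>0$ such that for all sufficiently large $r>0$ there is a cover $\mathcal{U}=\bigcup_{i=1}^{n+1}\mathcal{U}_i$ of $(X,d)$ such that each $\mathcal{U}_i$ is $r$-disjoint and every element of $\mathcal{U}$ has diameter at most $C r$. *)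

theory Defs
  imports "HOL-Analysis.Analysis"
begin

definition r_disjoint :: "'a metric \<Rightarrow> real \<Rightarrow> 'a set set \<Rightarrow> bool" where
  "r_disjoint m r \<U> \<longleftrightarrow>
     (\<forall>A\<in>\<U>. \<forall>B\<in>\<U>. A \<noteq> B \<longrightarrow> (\<forall>x\<in>A. \<forall>y\<in>B. r \<le> mdist m x y))"

text \<open>The diameter is extended-valued, so that unbounded sets have diameter \<open>\<infinity>\<close>;
  the empty set has diameter \<open>0\<close>, the bottom element of \<open>ennreal\<close>.\<close>

definition mdiameter :: "'a metric \<Rightarrow> 'a set \<Rightarrow> ennreal" where
  "mdiameter m A = (SUP (x, y)\<in>A \<times> A. ennreal (mdist m x y))"

lemma mdiameter_le_iff:
  assumes "0 \<le> D"
  shows "mdiameter m A \<le> ennreal D \<longleftrightarrow> (\<forall>x\<in>A. \<forall>y\<in>A. mdist m x y \<le> D)"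
  using assms by (auto simp: mdiameter_def SUP_le_iff ennreal_le_iff)

definition has_disjoint_cover :: "'a metric \<Rightarrow> nat \<Rightarrow> real \<Rightarrow> real \<Rightarrow> bool" where
  "has_disjoint_cover m n r D \<longleftrightarrow>
     (\<exists>\<U> :: nat \<Rightarrow> 'a set set.
        \<Union>(\<Union>i\<in>{1..n+1}. \<U> i) = mspace m \<and>
        (\<forall>i\<in>{1..n+1}. r_disjoint m r (\<U> i)) \<and>
        (\<forall>A\<in>(\<Union>i\<in>{1..n+1}. \<U> i). mdiameter m A \<le> ennreal D))"

definition dim_NA_le :: "'a metric \<Rightarrow> nat \<Rightarrow> bool" where
  "dim_NA_le m n \<longleftrightarrow> (\<exists>C>0. \<forall>r>0. has_disjoint_cover m n r (C * r))"

definition max_metric :: "real \<Rightarrow> 'a metric \<Rightarrow> 'a metric" where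
  "max_metric \<epsilon> m =
     metric (mspace m, \<lambda>x y. if x = y then 0 else max (mdist m x y) \<epsilon>)"

text \<open>The function in \<open>max_metric\<close> is a metric, so the abstraction function \<open>metric\<close> is applied
  within its domain and the expected projections hold.\<close>

lemma Metric_space_max_dist:
  "Metric_space (mspace m) (\<lambda>x y. if x = y then 0 else max (mdist m x y) \<epsilon>)"
proof
  show "((if x = y then 0 else max (mdist m x y) \<epsilon>) = 0) = (x = y)"
    if "x \<in> mspace m" "y \<in> mspace m" for x y
    using that by (smt (verit) mdist_nonneg mdist_zero)
next
  fix x y z
  assume "x \<in> mspace m" "y \<in> mspace m" "z \<in> mspace m"
  then have "mdist m x z \<le> mdist m x y + mdist m y z"
    by (rule mdist_triangle)
  then show "(if x = z then 0 else max (mdist m x z) \<epsilon>)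
      \<le> (if x = y then 0 else max (mdist m x y) \<epsilon>) + (if y = z then 0 else max (mdist m y z) \<epsilon>)"
    using mdist_nonneg[of m x y] mdist_nonneg[of m y z] by (smt (verit))
qed (auto simp: max_def mdist_commute intro: order_trans[OF mdist_nonneg])

lemma mspace_max_metric [simp]: "mspace (max_metric \<epsilon> m) = mspace m"
  by (simp add: max_metric_def Metric_space.mspace_metric[OF Metric_space_max_dist])

lemma mdist_max_metric [simp]:
  "mdist (max_metric \<epsilon> m) x y = (if x = y then 0 else max (mdist m x y) \<epsilon>)"
  by (simp add: max_metric_def Metric_space.mdist_metric[OF Metric_space_max_dist])

definition macroscopic_dim_NA_le :: "'a metric \<Rightarrow> nat \<Rightarrow> bool" where
  "macroscopic_dim_NA_le m n \<longleftrightarrow> dim_NA_le (max_metric 1 m) n"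

definition asdim_le_Higson :: "'a metric \<Rightarrow> nat \<Rightarrow> bool" where
  "asdim_le_Higson m n \<longleftrightarrow> (\<exists>C>0. \<forall>\<^sub>F r in at_top. has_disjoint_cover m n r (C * r))"

end

(*
  Above scale 1 the metrics d and max(d,1) agree, so r-disjoint covers can be transferred with the
  diameter bound changed by at most 1.  At scales r <= 1 the singletons are an r-disjoint cover for
  max(d,1) of diameter 0; the intermediate scales up to the Higson threshold R reuse the cover at
  scale R, at the cost of a factor R in the constant.
*)
theory Submission
  imports Defs
begin

lemma mdist_refl: "x \<in> mspace m \<Longrightarrow> mdist m x x = 0"
  using mdist_zero[of x m x] by blast

lemma has_disjoint_coverI:
  assumes "\<Union>(\<Union>i\<in>{1..n+1}. \<U> i) = mspace m" "0 \<le> D"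
    and "\<And>i A B x y. \<lbrakk>i \<in> {1..n+1}; A \<in> \<U> i; B \<in> \<U> i; A \<noteq> B; x \<in> A; y \<in> B\<rbrakk> \<Longrightarrow> r \<le> mdist m x y"
    and "\<And>i A x y. \<lbrakk>i \<in> {1..n+1}; A \<in> \<U> i; x \<in> A; y \<in> A\<rbrakk> \<Longrightarrow> mdist m x y \<le> D"
  shows "has_disjoint_cover m n r D"
  unfolding has_disjoint_cover_def r_disjoint_def
  using assms by (intro exI[of _ \<U>]) (auto simp: mdiameter_le_iff)

text \<open>Replaces the extended-valued diameter by bounds on pairs of points. The sign of
  \<open>D\<close> matters: \<open>ennreal\<close> truncates negative reals to 0, so a negative
  \<open>D\<close> would only give distances at most 0.\<close>

lemma has_disjoint_coverE:
  assumes "has_disjoint_cover m n r D" "0 \<le> D"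
  obtains \<U> where "\<Union>(\<Union>i\<in>{1..n+1}. \<U> i) = mspace m"
    and "\<And>i A B x y. \<lbrakk>i \<in> {1..n+1}; A \<in> \<U> i; B \<in> \<U> i; A \<noteq> B; x \<in> A; y \<in> B\<rbrakk> \<Longrightarrow> r \<le> mdist m x y"
    and "\<And>i A x y. \<lbrakk>i \<in> {1..n+1}; A \<in> \<U> i; x \<in> A; y \<in> A\<rbrakk> \<Longrightarrow> mdist m x y \<le> D"
proof -
  obtain \<U> where \<U>: "\<Union>(\<Union>i\<in>{1..n+1}. \<U> i) = mspace m"
      "\<forall>i\<in>{1..n+1}. r_disjoint m r (\<U> i)"
      "\<forall>A\<in>(\<Union>i\<in>{1..n+1}. \<U> i). mdiameter m A \<le> ennreal D"
    using assms(1) unfolding has_disjoint_cover_def by (elim exE conjE)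
  show thesis
  proof (rule that[OF \<U>(1)])
    show "r \<le> mdist m x y"
      if "i \<in> {1..n+1}" "A \<in> \<U> i" "B \<in> \<U> i" "A \<noteq> B" "x \<in> A" "y \<in> B" for i A B x y
      using \<U>(2) that unfolding r_disjoint_def by blast
    show "mdist m x y \<le> D" if "i \<in> {1..n+1}" "A \<in> \<U> i" "x \<in> A" "y \<in> A" for i A x y
    proof -
      have "mdiameter m A \<le> ennreal D"
        using \<U>(3) that(1,2) by blast
      then show ?thesis
        using that(3,4) by (simp add: mdiameter_le_iff[OF assms(2)])
    qed
  qed
qed

text \<open>The same sets serve for both metrics, since disjointness and diameter only involve pairs
  of points. With \<open>m' = m\<close> it also lowers the scale and enlarges the diameter
  bound.\<close>

lemma has_disjoint_cover_transfer:
  assumes "has_disjoint_cover m n r D" "0 \<le> D" "0 \<le> D'" and space: "mspace m' = mspace m"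
    and disj: "\<And>x y. \<lbrakk>x \<in> mspace m; y \<in> mspace m; r \<le> mdist m x y\<rbrakk> \<Longrightarrow> r' \<le> mdist m' x y"
    and diam: "\<And>x y. \<lbrakk>x \<in> mspace m; y \<in> mspace m; mdist m x y \<le> D\<rbrakk> \<Longrightarrow> mdist m' x y \<le> D'"
  shows "has_disjoint_cover m' n r' D'"
  using assms(1,2)
proof (rule has_disjoint_coverE)
  fix \<U>
  assume \<U>: "\<Union>(\<Union>i\<in>{1..n+1}. \<U> i) = mspace m"
    "\<And>i A B x y. \<lbrakk>i \<in> {1..n+1}; A \<in> \<U> i; B \<in> \<U> i; A \<noteq> B; x \<in> A; y \<in> B\<rbrakk> \<Longrightarrow> r \<le> mdist m x y"
    "\<And>i A x y. \<lbrakk>i \<in> {1..n+1}; A \<in> \<U> i; x \<in> A; y \<in> A\<rbrakk> \<Longrightarrow> mdist m x y \<le> D"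
  have sub: "x \<in> mspace m" if "i \<in> {1..n+1}" "A \<in> \<U> i" "x \<in> A" for i A x
    using \<U>(1) that by blast
  show ?thesis
  proof (rule has_disjoint_coverI[where \<U> = \<U>])
    show "\<Union>(\<Union>i\<in>{1..n+1}. \<U> i) = mspace m'"
      using \<U>(1) space by simp
    show "r' \<le> mdist m' x y"
      if "i \<in> {1..n+1}" "A \<in> \<U> i" "B \<in> \<U> i" "A \<noteq> B" "x \<in> A" "y \<in> B" for i A B x y
      by (rule disj[OF sub[OF that(1,2,5)] sub[OF that(1,3,6)] \<U>(2)[OF that]])
    show "mdist m' x y \<le> D'" if "i \<in> {1..n+1}" "A \<in> \<U> i" "x \<in> A" "y \<in> A" for i A x y
      by (rule diam[OF sub[OF that(1,2,3)] sub[OF that(1,2,4)] \<U>(3)[OF that]])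
  qed (fact \<open>0 \<le> D'\<close>)
qed

lemma has_disjoint_cover_singletons:
  assumes "\<And>x y. \<lbrakk>x \<in> mspace m; y \<in> mspace m; x \<noteq> y\<rbrakk> \<Longrightarrow> r \<le> mdist m x y" "0 \<le> D"
  shows "has_disjoint_cover m n r D"
  \<comment> \<open>Every index gets the same family: disjointness is only required within one
    index.\<close>
  by (rule has_disjoint_coverI[where \<U> = "\<lambda>_. (\<lambda>x. {x}) ` mspace m"]) (use assms in \<open>auto simp: mdist_refl\<close>)

text \<open>If the maximum of d and \<epsilon> is at least r > \<epsilon>, then d itself is at least
  r. For 0 < r \<le> \<epsilon> all distinct points are r-separated in the new metric, which says
  nothing about d.\<close>

lemma has_disjoint_cover_of_max_metric:
  assumes "has_disjoint_cover (max_metric \<epsilon> m) n r D" "0 \<le> D" "0 < r" "\<epsilon> < r"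
  shows "has_disjoint_cover m n r D"
  by (rule has_disjoint_cover_transfer[OF assms(1)])
    (use assms(2-) in \<open>auto simp: max_def mdist_refl split: if_splits\<close>)

text \<open>Distances between distinct points only grow, so separation survives; r > 0 makes
  separated points distinct.\<close>

lemma has_disjoint_cover_max_metric:
  assumes "has_disjoint_cover m n r D" "0 \<le> D" "0 < r"
  shows "has_disjoint_cover (max_metric \<epsilon> m) n r (max D \<epsilon>)"
  by (rule has_disjoint_cover_transfer[OF assms(1)]) (use assms in \<open>auto simp: mdist_refl\<close>)

theorem corollary2p8:
  fixes X :: "'a metric" and n :: nat
  shows "macroscopic_dim_NA_le X n \<longleftrightarrow> asdim_le_Higson X n"
proof
  assume "macroscopic_dim_NA_le X n"
  then obtain C where C: "C > 0"
    "\<And>r. r > 0 \<Longrightarrow> has_disjoint_cover (max_metric 1 X) n r (C * r)"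
    unfolding macroscopic_dim_NA_le_def dim_NA_le_def by blast
  have "\<forall>\<^sub>F r in at_top. has_disjoint_cover X n r (C * r)"
    using eventually_gt_at_top[of "1::real"]
    by eventually_elim (rule has_disjoint_cover_of_max_metric[OF C(2)], use C(1) in auto)
  with C(1) show "asdim_le_Higson X n"
    unfolding asdim_le_Higson_def by blast
next
  assume "asdim_le_Higson X n"
  then obtain C R0 where C: "C > 0" "\<And>r. r \<ge> R0 \<Longrightarrow> has_disjoint_cover X n r (C * r)"
    unfolding asdim_le_Higson_def eventually_at_top_linorder by metis
  define R where "R = max R0 1"
  \<comment> \<open>The factor \<open>max C 1\<close> absorbs the floor 1 that
    \<open>max_metric\<close> puts under the diameter bound; the factor \<open>R\<close> pays for
    working at scale \<open>max r R\<close> instead of \<open>r\<close>.\<close>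
  define K where "K = max C 1 * R"
  have R: "R \<ge> 1" and K: "K > 0"
    by (auto simp: R_def K_def)
  have "has_disjoint_cover (max_metric 1 X) n r (K * r)" if "r > 0" for r
  proof (cases "r \<le> 1")
    case True
    then show ?thesis
      using K that by (intro has_disjoint_cover_singletons) auto
  next
    case False
    define s where "s = max r R"
    have s: "r \<le> s" "R0 \<le> s" "1 \<le> s"
      using R by (auto simp: s_def R_def)
    \<comment> \<open>Both terms of the maximum are at most R r: r because R \<ge> 1, and R because
      r > 1 in this case.\<close>
    have "s \<le> R * r"
      using R False mult_mono[of 1 R r r] mult_mono[of R R 1 r] by (auto simp: s_def)
    then have "max C 1 * s \<le> K * r"
      using mult_left_mono[of s "R * r" "max C 1"] by (simp add: K_def mult.assoc)
    moreover have "C * s \<le> max C 1 * s" "1 \<le> max C 1 * s"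
      using s(3) mult_mono[of 1 "max C 1" 1 s] by (auto intro: mult_right_mono)
    ultimately have bound: "max (C * s) 1 \<le> K * r"
      by simp
    have "has_disjoint_cover (max_metric 1 X) n s (max (C * s) 1)"
      using C s by (intro has_disjoint_cover_max_metric) auto
    \<comment> \<open>The metric stays fixed here: since r \<le> s, an s-disjoint family is
      r-disjoint, and \<open>bound\<close> handles the diameters.\<close>
    then show ?thesis
      by (rule has_disjoint_cover_transfer) (use bound s(1) K that in auto)
  qed
  with K show "macroscopic_dim_NA_le X n"
    unfolding macroscopic_dim_NA_le_def dim_NA_le_def by blast
qed

end
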